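(* There exists a constant $n_0\in\mathbb{N}$ such that the following holds for all integers $n>n_0$. Let $p\in[0,1]$ and set $q=\min(p,1-p)$, and suppose that $q\geq 100\log n/\sqrt{n}$. Let $k$ be a positive integer with $k\leq q\sqrt{n}/100$, and let $G\sim G(n,p)$. Then the probability that $G$ is $k$-vertex-minor universal is at least $1-2^{-q^2n/100}$.
   Context: $G(n,p)$ denotes the Erdős–Rényi random graph on the vertex set $[n]=\{1,\dots,n\}$ in which each pair of distinct vertices is an edge independently with probability $p$. All graphs are simple. For a graph $G$ and a vertex $v\in V(G)$, the local complementation at $v$ produces the graph $G*v$ on the same vertex set obtained from $G$ by replacing the induced subgraph on the neighborhood $N(v)$ by its complement (i.e. for every pair of distinct vertices $x,y\in N(v)$, $xy$ is an edge of $G*v$ iff it is not an edge of $G$; all other adjacencies are unchanged). For a graph $H$ with $V(H)\subseteq V(G)$, $H$ is a vertex-minor of $G$ if $H$ can be obtained from $G$ by a sequence of vertex deletions and local complementations; equivalently, $H$ is the induced subgraph on $V(H)$ of some graph obtained from $G$ by a sequence of local complementations. A graph $G$ is $k$-vertex-minor universal if for every subset $U\subseteq V(G)$ with $|U|=k$, every graph with vertex set $U$ is a vertex-minor of $G$. *)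

theory Defs
  imports "HOL-Probability.Probability" "HOL-Library.Ramsey"
begin

text \<open>Finite simple graphs are pairs of a vertex set and a set of edges, an edge being a
  two-element set of vertices; \<^term>\<open>nsets A 2\<close> is the set of all two-element subsets of \<^term>\<open>A\<close>.\<close>

type_synonym 'a sgraph = "'a set \<times> 'a set set"

abbreviation verts :: "'a sgraph \<Rightarrow> 'a set" where
  "verts G \<equiv> fst G"

abbreviation edges :: "'a sgraph \<Rightarrow> 'a set set" where
  "edges G \<equiv> snd G"

definition simple_graph :: "'a sgraph \<Rightarrow> bool" where
  "simple_graph G \<longleftrightarrow> finite (verts G) \<and> edges G \<subseteq> nsets (verts G) 2"

definition neighborhood :: "'a sgraph \<Rightarrow> 'a \<Rightarrow> 'a set" where
  "neighborhood G v = {w \<in> verts G. {v, w} \<in> edges G}"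

definition delete_vertex :: "'a sgraph \<Rightarrow> 'a \<Rightarrow> 'a sgraph" where
  "delete_vertex G v = (verts G - {v}, {e \<in> edges G. v \<notin> e})"

definition local_complement :: "'a sgraph \<Rightarrow> 'a \<Rightarrow> 'a sgraph" where
  "local_complement G v =
     (verts G,
      (edges G - nsets (neighborhood G v) 2) \<union> (nsets (neighborhood G v) 2 - edges G))"

text \<open>\<open>has_vertex_minor G H\<close>: the graph \<open>H\<close> is a vertex-minor of \<open>G\<close>. Vertices are labelled;
  there is no closure under isomorphism.\<close>

inductive has_vertex_minor :: "'a sgraph \<Rightarrow> 'a sgraph \<Rightarrow> bool" for G where
  refl: "has_vertex_minor G G"
| delete: "has_vertex_minor G H \<Longrightarrow> v \<in> verts H \<Longrightarrow> has_vertex_minor G (delete_vertex H v)"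
| local: "has_vertex_minor G H \<Longrightarrow> v \<in> verts H \<Longrightarrow> has_vertex_minor G (local_complement H v)"

definition vertex_minor_universal :: "nat \<Rightarrow> 'a sgraph \<Rightarrow> bool" where
  "vertex_minor_universal k G \<longleftrightarrow>
     (\<forall>U. U \<subseteq> verts G \<and> card U = k \<longrightarrow>
        (\<forall>H. simple_graph H \<and> verts H = U \<longrightarrow> has_vertex_minor G H))"

definition random_graph :: "nat \<Rightarrow> real \<Rightarrow> nat sgraph pmf" where
  "random_graph n p =
     map_pmf (\<lambda>f. ({1..n}, {e \<in> nsets {1..n} 2. f e}))
       (Pi_pmf (nsets {1..n} 2) False (\<lambda>_. bernoulli_pmf p))"

lemma edge_local_complement_iff:
  assumes "x \<noteq> y"
  shows "{x, y} \<in> edges (local_complement G v) \<longleftrightarrow>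
    (if x \<in> neighborhood G v \<and> y \<in> neighborhood G v then {x, y} \<notin> edges G else {x, y} \<in> edges G)"
  using assms by (auto simp: local_complement_def nsets_def)

lemma simple_graph_local_complement:
  "simple_graph G \<Longrightarrow> simple_graph (local_complement G v)"
  by (auto simp: simple_graph_def local_complement_def nsets_def neighborhood_def)

lemma simple_graph_delete_vertex:
  "simple_graph G \<Longrightarrow> simple_graph (delete_vertex G v)"
  by (auto simp: simple_graph_def delete_vertex_def nsets_def)

lemma simple_graph_random_graph:
  "G \<in> set_pmf (random_graph n p) \<Longrightarrow> simple_graph G \<and> verts G = {1..n}"
  by (auto simp: random_graph_def simple_graph_def)

end

theory Submission
  imports Defs "HOL-Library.Z2"
begin

text \<open>Fix a vertex set \<open>U\<close> of size \<open>k\<close> and an ordering of its complement \<open>W\<close>. For \<open>S \<subseteq> W\<close>, run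
  through \<open>W\<close> and delete every vertex, after a local complementation if it lies in \<open>S\<close>. Over the
  two-element field the adjacency of \<open>x, y \<in> U\<close> in the resulting graph differs from the original one
  by \<open>\<beta>\<^sub>S(N(x), N(y))\<close>, where \<open>\<beta>\<^sub>S\<close> is a symmetric bilinear form that depends only on the edges inside
  \<open>W\<close>, involves only the coordinates in \<open>S\<close>, and is nondegenerate on them. Hence
  the sum of the forms for \<open>S\<close> and \<open>S'\<close> has rank at least \<open>|S - S'|\<close>, and the
  randomness of the edges between \<open>U\<close> and \<open>W\<close> alone shows
  that a nontrivial character of the edge space of \<open>U\<close> correlates by at most \<open>(1 - 2q\<^sup>2)\<^bsup>|S - S'|\<^esup>\<close>
  on the graphs obtained from \<open>S\<close> and \<open>S'\<close>. Averaged over \<open>S\<close> and \<open>S'\<close> this is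
  \<open>(1 - q\<^sup>2/2)\<^bsup>n-k\<^esup>\<close>, so by Fourier inversion and the second moment method every graph on \<open>U\<close>
  is reached for some \<open>S\<close>, except with probability \<open>4\<close> to the power \<open>k choose 2\<close> times
  \<open>(1 - q\<^sup>2/2)\<^bsup>n-k\<^esup>\<close>. A union bound over \<open>U\<close> finishes the proof.\<close>

text \<open>These two simp rules turn the field operations into bitwise ones, which blocks the ring laws.\<close>

declare add_bit_eq_xor [simp del] mult_bit_eq_and [simp del]

section \<open>Expectation over binomial random subsets\<close>

text \<open>A finite weighted sum instead of an expectation over a pmf, so that linearity and the
  exchange of averages are plain identities of finite sums. It serves the random edge set and, with
  \<open>p = 1 / 2\<close>, the random set \<open>S\<close>.\<close>

definition bexp :: "real \<Rightarrow> 'a set \<Rightarrow> ('a set \<Rightarrow> real) \<Rightarrow> real" where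
  "bexp p E f = (\<Sum>F\<in>Pow E. p ^ card F * (1 - p) ^ card (E - F) * f F)"

lemma bexp_empty [simp]: "bexp p {} f = f {}"
  by (simp add: bexp_def)

text \<open>Conditioning on whether \<open>e\<close> is chosen; this recursion drives the inductions
  on the ground set.\<close>

lemma bexp_insert:
  assumes "finite E" "e \<notin> E"
  shows "bexp p (insert e E) f = (1 - p) * bexp p E f + p * bexp p E (\<lambda>F. f (insert e F))"
proof -
  have inj: "inj_on (insert e) (Pow E)"
    using assms(2) by (auto simp: inj_on_def)
  have disj: "Pow E \<inter> insert e ` Pow E = {}"
    using assms(2) by auto
  have fin: "finite F" if "F \<subseteq> E" for F
    using assms(1) that finite_subset by blast
  have a: "p ^ card F * (1 - p) ^ card (insert e E - F) * f F =
      (1 - p) * (p ^ card F * (1 - p) ^ card (E - F) * f F)" if "F \<subseteq> E" for F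
  proof -
    have "insert e E - F = insert e (E - F)" "e \<notin> E - F"
      using that assms(2) by auto
    thus ?thesis using assms(1) by simp
  qed
  have b: "p ^ card (insert e F) * (1 - p) ^ card (insert e E - insert e F) * f (insert e F) =
      p * (p ^ card F * (1 - p) ^ card (E - F) * f (insert e F))" if "F \<subseteq> E" for F
  proof -
    have "insert e E - insert e F = E - F" "e \<notin> F"
      using that assms(2) by auto
    thus ?thesis using fin[OF that] by simp
  qed
  have "bexp p (insert e E) f =
      (\<Sum>F\<in>Pow E. p ^ card F * (1 - p) ^ card (insert e E - F) * f F) +
      (\<Sum>F\<in>Pow E. p ^ card (insert e F) * (1 - p) ^ card (insert e E - insert e F) * f (insert e F))"
    unfolding bexp_def Pow_insert
    by (subst sum.union_disjoint) (use assms(1) disj in \<open>simp_all add: sum.reindex[OF inj] o_def\<close>)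
  also have "\<dots> = (1 - p) * bexp p E f + p * bexp p E (\<lambda>F. f (insert e F))"
    unfolding bexp_def sum_distrib_left by (intro arg_cong2[where f = "(+)"] sum.cong a b) auto
  finally show ?thesis .
qed

lemma bexp_cong:
  "(\<And>F. F \<subseteq> E \<Longrightarrow> f F = g F) \<Longrightarrow> bexp p E f = bexp p E g"
  by (simp add: bexp_def)

lemma bexp_mono:
  assumes "0 \<le> p" "p \<le> 1" "\<And>F. F \<subseteq> E \<Longrightarrow> f F \<le> g F"
  shows "bexp p E f \<le> bexp p E g"
  unfolding bexp_def using assms by (intro sum_mono mult_left_mono) auto

lemma bexp_add: "bexp p E (\<lambda>F. f F + g F) = bexp p E f + bexp p E g"
  by (simp add: bexp_def sum.distrib algebra_simps)

lemma bexp_cmult: "bexp p E (\<lambda>F. c * f F) = c * bexp p E f"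
  by (simp add: bexp_def sum_distrib_left mult_ac)

lemma bexp_multc: "bexp p E (\<lambda>F. f F * c) = bexp p E f * c"
  by (simp add: bexp_def sum_distrib_right mult.assoc)

lemma bexp_minus: "bexp p E (\<lambda>F. - f F) = - bexp p E f"
  by (simp add: bexp_def sum_negf)

lemma bexp_sum: "bexp p E (\<lambda>F. \<Sum>i\<in>I. f i F) = (\<Sum>i\<in>I. bexp p E (f i))"
  unfolding bexp_def sum_distrib_left by (rule sum.swap)

lemma bexp_commute:
  "bexp p E (\<lambda>F. bexp r D (\<lambda>X. f F X)) = bexp r D (\<lambda>X. bexp p E (\<lambda>F. f F X))"
proof -
  have "bexp p E (\<lambda>F. bexp r D (\<lambda>X. f F X)) =
     (\<Sum>X\<in>Pow D. bexp p E (\<lambda>F. r ^ card X * (1 - r) ^ card (D - X) * f F X))"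
    unfolding bexp_def[of r] by (rule bexp_sum)
  also have "\<dots> = bexp r D (\<lambda>X. bexp p E (\<lambda>F. f F X))"
    unfolding bexp_cmult by (simp add: bexp_def[of r])
  finally show ?thesis .
qed

lemma bexp_const: "finite E \<Longrightarrow> bexp p E (\<lambda>_. c) = c"
  by (induction E rule: finite_induct) (auto simp: bexp_insert algebra_simps)

lemma bexp_abs_le:
  assumes "0 \<le> p" "p \<le> 1"
  shows "\<bar>bexp p E f\<bar> \<le> bexp p E (\<lambda>F. \<bar>f F\<bar>)"
proof -
  have "bexp p E f \<le> bexp p E (\<lambda>F. \<bar>f F\<bar>)"
    using assms by (intro bexp_mono) auto
  moreover have "- bexp p E f \<le> bexp p E (\<lambda>F. \<bar>f F\<bar>)"
    unfolding bexp_minus[symmetric] using assms by (intro bexp_mono) auto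
  ultimately show ?thesis by linarith
qed

lemma bexp_le_const:
  assumes "0 \<le> p" "p \<le> 1" "finite E" "\<And>F. F \<subseteq> E \<Longrightarrow> f F \<le> c"
  shows "bexp p E f \<le> c"
  using bexp_mono[of p E f "\<lambda>_. c"] bexp_const[OF assms(3), of p c] assms by simp

text \<open>The traces of a binomial random subset on disjoint sets are independent.\<close>

lemma bexp_union:
  assumes "finite A" "finite B" "A \<inter> B = {}"
  shows "bexp p (A \<union> B) f = bexp p A (\<lambda>X. bexp p B (\<lambda>Y. f (X \<union> Y)))"
  using assms(1,3)
proof (induction A arbitrary: f rule: finite_induct)
  case (insert a A)
  have "bexp p (insert a (A \<union> B)) f =
      (1 - p) * bexp p (A \<union> B) f + p * bexp p (A \<union> B) (\<lambda>F. f (insert a F))"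
    using insert.hyps insert.prems assms(2) by (intro bexp_insert) auto
  with insert show ?case
    by (simp add: bexp_insert)
qed simp

lemma bexp_image:
  assumes "finite A" "inj_on h A"
  shows "bexp p (h ` A) f = bexp p A (\<lambda>X. f (h ` X))"
  using assms
proof (induction A arbitrary: f rule: finite_induct)
  case (insert a A)
  have "bexp p (insert (h a) (h ` A)) f =
      (1 - p) * bexp p (h ` A) f + p * bexp p (h ` A) (\<lambda>F. f (insert (h a) F))"
    using insert.hyps insert.prems by (intro bexp_insert) auto
  with insert show ?case
    by (simp add: bexp_insert)
qed simp

lemma bexp_prod:
  assumes "finite E"
  shows "bexp p E (\<lambda>F. \<Prod>e\<in>E. f e (e \<in> F)) = (\<Prod>e\<in>E. (1 - p) * f e False + p * f e True)"
  using assms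
proof (induction E rule: finite_induct)
  case (insert x E)
  have 1: "bexp p E (\<lambda>F. \<Prod>e\<in>insert x E. f e (e \<in> F)) =
      f x False * bexp p E (\<lambda>F. \<Prod>e\<in>E. f e (e \<in> F))"
    unfolding bexp_cmult[symmetric]
  proof (rule bexp_cong)
    fix F assume "F \<subseteq> E"
    hence "x \<notin> F" using insert.hyps by auto
    thus "(\<Prod>e\<in>insert x E. f e (e \<in> F)) = f x False * (\<Prod>e\<in>E. f e (e \<in> F))"
      using insert.hyps by simp
  qed
  have "(\<Prod>e\<in>E. f e (e \<in> insert x F)) = (\<Prod>e\<in>E. f e (e \<in> F))" for F
  proof (rule prod.cong[OF HOL.refl])
    fix e assume "e \<in> E"
    hence "e \<noteq> x" using insert.hyps by auto
    thus "f e (e \<in> insert x F) = f e (e \<in> F)" by simp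
  qed
  hence 2: "bexp p E (\<lambda>F. \<Prod>e\<in>insert x E. f e (e \<in> insert x F)) =
      f x True * bexp p E (\<lambda>F. \<Prod>e\<in>E. f e (e \<in> F))"
    unfolding bexp_cmult[symmetric] using insert.hyps
    by (intro bexp_cong) auto
  show ?case
    unfolding bexp_insert[OF insert.hyps] 1 2 insert.IH
    using insert.hyps by (simp add: algebra_simps)
qed simp

section \<open>Transfer from the random graph to binomial sums\<close>

lemma prob_random_graph:
  assumes p: "0 \<le> p" "p \<le> 1"
  shows "measure_pmf.prob (random_graph n p) A =
     bexp p (nsets {1..n} 2) (\<lambda>F. of_bool (({1..n}, F) \<in> A))"
proof -
  define E :: "nat set set" where "E = nsets {1..n} 2"
  have fE: "finite E" unfolding E_def by (simp add: finite_imp_finite_nsets)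
  define P where "P = Pi_pmf E False (\<lambda>_. bernoulli_pmf p)"
  define h :: "(nat set \<Rightarrow> bool) \<Rightarrow> nat set set" where "h = (\<lambda>f. {e \<in> E. f e})"
  have supp: "set_pmf P \<subseteq> {f. \<forall>x. x \<notin> E \<longrightarrow> f x = False}"
    unfolding P_def by (rule set_Pi_pmf_subset[OF fE])
  have rg: "random_graph n p = map_pmf (\<lambda>f. ({1..n}, h f)) P"
    by (simp add: random_graph_def P_def h_def E_def)
  define C where "C = (\<lambda>F e. e \<in> F) ` {F \<in> Pow E. ({1..n}, F) \<in> A}"
  have inj: "inj_on (\<lambda>F (e::nat set). e \<in> F) {F \<in> Pow E. ({1..n}, F) \<in> A}"
    by (auto simp: inj_on_def fun_eq_iff)
  have pm: "pmf P (\<lambda>e. e \<in> F) = p ^ card F * (1 - p) ^ card (E - F)" if "F \<subseteq> E" for F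
  proof -
    have "pmf P (\<lambda>e. e \<in> F) = (\<Prod>e\<in>E. pmf (bernoulli_pmf p) (e \<in> F))"
      unfolding P_def using that by (intro pmf_Pi'[OF fE]) auto
    also have "\<dots> = (\<Prod>e\<in>F. pmf (bernoulli_pmf p) (e \<in> F)) * (\<Prod>e\<in>E - F. pmf (bernoulli_pmf p) (e \<in> F))"
      by (subst prod.subset_diff[OF that fE]) (rule mult.commute)
    also have "\<dots> = p ^ card F * (1 - p) ^ card (E - F)"
      using p by simp
    finally show ?thesis .
  qed
  have "measure_pmf.prob (random_graph n p) A = measure_pmf.prob P {f. ({1..n}, h f) \<in> A}"
    unfolding rg by (simp add: vimage_def)
  \<comment> \<open>\<open>h\<close> forgets the values outside \<open>E\<close>, so the two events
    differ only in functions that are true somewhere outside \<open>E\<close>. The default value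
    \<open>False\<close> makes these null.\<close>
  also have "\<dots> = measure_pmf.prob P C"
  proof (rule measure_pmf.finite_measure_eq_AE)
    show "AE f in measure_pmf P. (f \<in> {f. ({1..n}, h f) \<in> A}) = (f \<in> C)"
    proof (rule AE_pmfI)
      fix f assume "f \<in> set_pmf P"
      with supp have f: "f = (\<lambda>e. e \<in> h f)" "h f \<subseteq> E"
        by (auto simp: h_def)
      have "f \<in> C" if "({1..n}, h f) \<in> A"
        unfolding C_def by (rule image_eqI[of _ _ "h f"]) (use that f in auto)
      moreover have "({1..n}, h f) \<in> A" if "f \<in> C"
      proof -
        from that obtain F where "F \<subseteq> E" "({1..n}, F) \<in> A" "f = (\<lambda>e. e \<in> F)"
          by (auto simp: C_def)
        moreover from this have "h f = F" by (auto simp: h_def)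
        ultimately show ?thesis by simp
      qed
      ultimately show "(f \<in> {f. ({1..n}, h f) \<in> A}) = (f \<in> C)" by blast
    qed
  qed auto
  also have "\<dots> = sum (pmf P) C"
    by (rule measure_measure_pmf_finite) (simp add: C_def fE)
  also have "\<dots> = (\<Sum>F\<in>{F \<in> Pow E. ({1..n}, F) \<in> A}. p ^ card F * (1 - p) ^ card (E - F))"
    unfolding C_def sum.reindex[OF inj] by (intro sum.cong) (auto simp: pm)
  also have "\<dots> = bexp p E (\<lambda>F. of_bool (({1..n}, F) \<in> A))"
    unfolding bexp_def using fE
    by (simp add: sum.inter_filter) (intro sum.cong; auto)
  finally show ?thesis by (simp add: E_def)
qed

section \<open>Anticoncentration of affine maps over the two-element field\<close>

lemma bit_add_self [simp]: "a + a = (0::bit)" "a + (a + b) = (b::bit)"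
  by (cases a; cases b; simp)+

text \<open>Induction on \<open>I\<close>: the entry at \<open>i\<close> is constant with probability \<open>1 - 2q\<close> and uniform otherwise;
  in the uniform case a row \<open>j0\<close> with \<open>c i j0 = 1\<close> is eliminated against column \<open>i\<close>.\<close>

lemma affine_image_weight_bound:
  fixes p q \<theta> :: real and c :: "'a \<Rightarrow> 'b \<Rightarrow> bit" and g :: "'b \<Rightarrow> bit"
  assumes p: "0 \<le> p" "p \<le> 1" and q: "q = min p (1 - p)" and \<theta>: "\<theta> = 1 - 2 * q"
    and "finite I" "finite J"
    and "\<And>T. T \<subseteq> I \<Longrightarrow> T \<noteq> {} \<Longrightarrow> \<exists>j\<in>J. (\<Sum>i\<in>T. c i j) = 1"
  shows "bexp p I (\<lambda>A. \<Prod>j\<in>J. if g j + (\<Sum>i\<in>A. c i j) = 1 then \<theta> else 1) \<le> (1 - 2 * q\<^sup>2) ^ card I"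
  using assms(5-)
proof (induction I arbitrary: J c g rule: finite_induct)
  case empty
  have "0 \<le> \<theta>" "\<theta> \<le> 1" using p q \<theta> by (auto simp: min_def)
  thus ?case by (auto intro!: prod_le_1)
next
  case (insert i I)
  define w where "w = (\<lambda>b::bit. if b = 1 then \<theta> else 1)"
  have w01: "w 0 = 1" "w 1 = \<theta>" by (simp_all add: w_def)
  define \<rho> where "\<rho> = (1 - 2 * q\<^sup>2) ^ card I"
  have \<theta>0: "0 \<le> \<theta>" using p q \<theta> by (auto simp: min_def)
  have "0 \<le> q" "q \<le> 1 / 2"
    using p q by (auto simp: min_def)
  hence "q\<^sup>2 \<le> (1 / 2)\<^sup>2"
    by (intro power_mono) auto
  hence \<rho>0: "0 \<le> \<rho>" unfolding \<rho>_def by (intro zero_le_power) (simp add: power2_eq_square)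
  obtain j0 where j0: "j0 \<in> J" "c i j0 = 1"
    using insert.prems(2)[of "{i}"] by auto
  define J' where "J' = J - {j0}"
  have J: "J = insert j0 J'" "j0 \<notin> J'" "finite J'"
    using j0 insert.prems(1) by (auto simp: J'_def)
  \<comment> \<open>Output \<open>j0\<close> is added with coefficient \<open>c i j\<close> to every
    other output \<open>j\<close>. Since \<open>c i j0 = 1\<close>, the new outputs do not change
    when \<open>i\<close> joins \<open>A\<close>.\<close>
  define c' where "c' = (\<lambda>a j. c a j + c a j0 * c i j)"
  define g' where "g' = (\<lambda>j. g j + g j0 * c i j)"
  define X where "X = bexp p I (\<lambda>A. \<Prod>j\<in>J. w (g j + (\<Sum>a\<in>A. c a j)))"
  define Y where "Y = bexp p I (\<lambda>A. \<Prod>j\<in>J. w ((g j + c i j) + (\<Sum>a\<in>A. c a j)))"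
  have X: "X \<le> \<rho>" and Y: "Y \<le> \<rho>"
    unfolding X_def Y_def \<rho>_def w_def using insert.prems by (auto intro!: insert.IH)
  \<comment> \<open>Elimination preserves independence: if the new rows over \<open>T\<close> summed
    to zero on \<open>J'\<close>, then so would the old rows on \<open>J\<close> over
    \<open>T\<close> or \<open>insert i T\<close>, according to the sum over \<open>T\<close> at
    \<open>j0\<close>.\<close>
  have ind': "\<exists>j\<in>J'. (\<Sum>a\<in>T. c' a j) = 1" if T: "T \<subseteq> I" "T \<noteq> {}" for T
  proof (rule ccontr)
    assume "\<not> ?thesis"
    hence 0: "(\<Sum>a\<in>T. c a j) + (\<Sum>a\<in>T. c a j0) * c i j = 0" if "j \<in> J'" for j
      using that by (auto simp: c'_def sum.distrib sum_distrib_right)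
    have fT: "finite T" "i \<notin> T"
      using T insert.hyps finite_subset by auto
    show False
    proof (cases "(\<Sum>a\<in>T. c a j0) = 1")
      case True
      have "(\<Sum>a\<in>insert i T. c a j) = 0" if "j \<in> J" for j
        using that 0[of j] True fT j0 by (auto simp: J add.commute)
      thus False using insert.prems(2)[of "insert i T"] T by auto
    next
      case False
      hence "(\<Sum>a\<in>T. c a j) = 0" if "j \<in> J" for j
        using that 0[of j] by (auto simp: J)
      thus False using insert.prems(2)[of T] T by auto
    qed
  qed
  have X': "bexp p I (\<lambda>A. \<Prod>j\<in>J'. w (g' j + (\<Sum>a\<in>A. c' a j))) \<le> \<rho>"
    and Y': "bexp p I (\<lambda>A. \<Prod>j\<in>J'. w ((g' j + c i j) + (\<Sum>a\<in>A. c' a j))) \<le> \<rho>"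
    unfolding \<rho>_def w_def using ind' J(3) by (auto intro!: insert.IH)
  \<comment> \<open>For each \<open>A\<close>, adding \<open>i\<close> flips output
    \<open>j0\<close>, so exactly one of the two products has the factor \<theta> there. The other
    product consists of the eliminated outputs, and the one with \<theta> has them shifted by
    \<open>c i j\<close>.\<close>
  have "X + Y = bexp p I (\<lambda>A. (\<Prod>j\<in>J'. w (g' j + (\<Sum>a\<in>A. c' a j))) +
      \<theta> * (\<Prod>j\<in>J'. w ((g' j + c i j) + (\<Sum>a\<in>A. c' a j))))"
    unfolding X_def Y_def bexp_add[symmetric]
  proof (rule bexp_cong)
    fix A assume "A \<subseteq> I"
    define z where "z = (\<lambda>j. g j + (\<Sum>a\<in>A. c a j))"
    have z': "g' j + (\<Sum>a\<in>A. c' a j) = z j + z j0 * c i j" for j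
      by (simp add: g'_def c'_def z_def sum.distrib flip: sum_distrib_right) (simp add: algebra_simps)
    have l: "g j + c i j + (\<Sum>a\<in>A. c a j) = z j + c i j" for j
      by (simp add: z_def algebra_simps)
    have r: "g' j + c i j + (\<Sum>a\<in>A. c' a j) = z j + z j0 * c i j + c i j" for j
      using z'[of j] by (simp add: algebra_simps)
    have rr: "z j + c i j + c i j = z j" for j
      by (simp add: add.assoc)
    have "(\<Prod>j\<in>J. w (z j)) + (\<Prod>j\<in>J. w (z j + c i j)) =
      (\<Prod>j\<in>J'. w (z j + z j0 * c i j)) + \<theta> * (\<Prod>j\<in>J'. w (z j + z j0 * c i j + c i j))"
      by (cases "z j0") (use J j0 rr in \<open>simp_all add: w01\<close>)
    thus "(\<Prod>j\<in>J. w (g j + (\<Sum>a\<in>A. c a j))) + (\<Prod>j\<in>J. w (g j + c i j + (\<Sum>a\<in>A. c a j))) =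
      (\<Prod>j\<in>J'. w (g' j + (\<Sum>a\<in>A. c' a j))) + \<theta> * (\<Prod>j\<in>J'. w (g' j + c i j + (\<Sum>a\<in>A. c' a j)))"
      unfolding z' l r by (simp add: z_def)
  qed
  also have "\<dots> \<le> \<rho> + \<theta> * \<rho>"
    unfolding bexp_add bexp_cmult using X' Y' \<theta>0 by (intro add_mono mult_left_mono) auto
  finally have XY: "X + Y \<le> \<rho> + \<theta> * \<rho>" .
  have "bexp p I (\<lambda>A. \<Prod>j\<in>J. w (g j + (\<Sum>a\<in>insert i A. c a j))) = Y"
    unfolding Y_def
  proof (rule bexp_cong)
    fix A assume "A \<subseteq> I"
    hence "finite A" "i \<notin> A" using insert.hyps finite_subset by auto
    thus "(\<Prod>j\<in>J. w (g j + (\<Sum>a\<in>insert i A. c a j))) =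
      (\<Prod>j\<in>J. w ((g j + c i j) + (\<Sum>a\<in>A. c a j)))"
      by (simp add: algebra_simps)
  qed
  hence "bexp p (insert i I) (\<lambda>A. \<Prod>j\<in>J. w (g j + (\<Sum>i\<in>A. c i j))) = (1 - p) * X + p * Y"
    by (simp add: bexp_insert[OF insert.hyps] X_def)
  \<comment> \<open>Mass \<open>q\<close> from each of the two outcomes at \<open>i\<close> is
    grouped into \<open>X + Y\<close>; the excess \<open>1 - 2 * q\<close> stays with the likelier
    outcome. The resulting factor is
    \<open>(1 - 2 * q) + q * (1 + \<theta>) = 1 - 2 * q\<^sup>2\<close>.\<close>
  also have "\<dots> \<le> (1 - 2 * q\<^sup>2) * \<rho>"
  proof (cases "p \<le> 1 / 2")
    case True
    hence qp: "q = p" using q by auto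
    have "(1 - p) * X + p * Y = (1 - 2 * p) * X + p * (X + Y)"
      by (simp add: algebra_simps)
    also have "\<dots> \<le> (1 - 2 * p) * \<rho> + p * (\<rho> + \<theta> * \<rho>)"
      using True p by (intro add_mono[OF mult_left_mono[OF X] mult_left_mono[OF XY]]) auto
    finally show ?thesis by (simp add: \<theta> qp algebra_simps power2_eq_square)
  next
    case False
    hence qp: "p = 1 - q" and "0 \<le> q" "q \<le> 1 / 2" using q p by auto
    have "(1 - p) * X + p * Y = (1 - 2 * q) * Y + q * (X + Y)"
      by (simp add: qp algebra_simps)
    also have "\<dots> \<le> (1 - 2 * q) * \<rho> + q * (\<rho> + \<theta> * \<rho>)"
      using \<open>0 \<le> q\<close> \<open>q \<le> 1 / 2\<close>
      by (intro add_mono[OF mult_left_mono[OF Y] mult_left_mono[OF XY]]) auto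
    finally show ?thesis by (simp add: \<theta> algebra_simps power2_eq_square)
  qed
  finally show ?case
    using insert.hyps by (simp add: w_def \<rho>_def)
qed

section \<open>Eliminating vertices by local complementation\<close>

definition adj :: "'a sgraph \<Rightarrow> 'a \<Rightarrow> 'a \<Rightarrow> bit" where
  "adj G x y = of_bool ({x, y} \<in> edges G)"

lemma adj_commute: "adj G x y = adj G y x"
  by (simp add: adj_def insert_commute)

primrec eliminate :: "'a set \<Rightarrow> 'a list \<Rightarrow> 'a sgraph \<Rightarrow> 'a sgraph" where
  "eliminate S [] G = G"
| "eliminate S (w # ws) G =
     eliminate S ws (delete_vertex (if w \<in> S then local_complement G w else G) w)"

lemma verts_delete_vertex [simp]: "verts (delete_vertex G v) = verts G - {v}"
  by (simp add: delete_vertex_def)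

lemma verts_local_complement [simp]: "verts (local_complement G v) = verts G"
  by (simp add: local_complement_def)

lemma verts_eliminate [simp]: "verts (eliminate S ws G) = verts G - set ws"
  by (induction ws arbitrary: G) auto

lemma simple_graph_eliminate: "simple_graph G \<Longrightarrow> simple_graph (eliminate S ws G)"
  by (induction ws arbitrary: G)
     (auto simp: simple_graph_delete_vertex simple_graph_local_complement)

lemma has_vertex_minor_eliminate:
  assumes "has_vertex_minor G0 G" "distinct ws" "set ws \<subseteq> verts G"
  shows "has_vertex_minor G0 (eliminate S ws G)"
  using assms
proof (induction ws arbitrary: G)
  case (Cons w ws)
  have "has_vertex_minor G0 (delete_vertex (if w \<in> S then local_complement G w else G) w)"
    using Cons.prems by (auto intro: has_vertex_minor.intros)
  thus ?case
    using Cons.prems by (auto intro!: Cons.IH)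
qed simp

lemma adj_delete_vertex:
  "x \<noteq> w \<Longrightarrow> y \<noteq> w \<Longrightarrow> adj (delete_vertex G w) x y = adj G x y"
  by (simp add: adj_def delete_vertex_def)

text \<open>Off the diagonal, local complementation adds the outer square of row \<open>w\<close>: a
  step of symmetric Gaussian elimination over the two-element field with pivot 1.\<close>

lemma adj_local_complement:
  assumes "x \<noteq> y" "x \<in> verts G" "y \<in> verts G"
  shows "adj (local_complement G w) x y = adj G x y + adj G w x * adj G w y"
  using assms by (simp add: adj_def edge_local_complement_iff neighborhood_def)

text \<open>The correction term of the Schur complement of the block indexed by \<open>S\<close> in the symmetric
  matrix \<open>M\<close>, where each diagonal entry is taken to be 1 at the moment its vertex is eliminated.
  The diagonal of \<open>M\<close> is therefore irrelevant.\<close>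

primrec schur ::
  "'a set \<Rightarrow> ('a \<Rightarrow> 'a \<Rightarrow> bit) \<Rightarrow> 'a list \<Rightarrow> ('a \<Rightarrow> bit) \<Rightarrow> ('a \<Rightarrow> bit) \<Rightarrow> bit" where
  "schur S M [] a b = 0"
| "schur S M (w # ws) a b =
     (if w \<in> S
      then a w * b w + schur S (\<lambda>x y. M x y + M w x * M w y) ws
             (\<lambda>i. a i + a w * M w i) (\<lambda>i. b i + b w * M w i)
      else schur S M ws a b)"

lemma schur_commute: "schur S M ws a b = schur S M ws b a"
  by (induction ws arbitrary: M a b) (auto simp: mult.commute)

text \<open>The updated vector depends linearly on the old one, so additivity passes through the
  recursion. Together with symmetry this makes \<open>schur\<close> bilinear.\<close>

lemma schur_add_left:
  "schur S M ws (\<lambda>i. a i + a' i) b = schur S M ws a b + schur S M ws a' b"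
proof (induction ws arbitrary: M a a' b)
  case (Cons w ws)
  have "(\<lambda>i. a i + a' i + (a w + a' w) * M w i) =
      (\<lambda>i. (a i + a w * M w i) + (a' i + a' w * M w i))"
    by (simp add: algebra_simps)
  thus ?case
    by (simp add: Cons.IH) (simp add: algebra_simps)
qed simp

text \<open>A coordinate is read only when its vertex serves as pivot.\<close>

lemma schur_cong_vec:
  assumes "\<And>i. i \<in> S \<Longrightarrow> i \<in> set ws \<Longrightarrow> a i = a' i" "\<And>i. i \<in> S \<Longrightarrow> i \<in> set ws \<Longrightarrow> b i = b' i"
  shows "schur S M ws a b = schur S M ws a' b'"
  using assms
proof (induction ws arbitrary: M a b a' b')
  case (Cons w ws)
  show ?case
  proof (cases "w \<in> S")
    case True
    hence w: "a w = a' w" "b w = b' w" using Cons.prems by auto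
    have "schur S (\<lambda>x y. M x y + M w x * M w y) ws (\<lambda>i. a i + a w * M w i) (\<lambda>i. b i + b w * M w i) =
        schur S (\<lambda>x y. M x y + M w x * M w y) ws (\<lambda>i. a' i + a' w * M w i) (\<lambda>i. b' i + b' w * M w i)"
      by (rule Cons.IH) (use Cons.prems w in auto)
    with True w show ?thesis by simp
  next
    case False
    have "schur S M ws a b = schur S M ws a' b'"
      by (rule Cons.IH) (use Cons.prems in auto)
    with False show ?thesis by simp
  qed
qed simp

text \<open>The entries that matter join a pivot to a later vertex, and distinctness of
  \<open>ws\<close> keeps these off the diagonal. Matrix identities that hold only off the diagonal
  can therefore be used.\<close>

lemma schur_cong_matrix:
  assumes "distinct ws" "\<And>i j. i \<in> set ws \<Longrightarrow> j \<in> set ws \<Longrightarrow> i \<noteq> j \<Longrightarrow> M i j = M' i j"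
  shows "schur S M ws a b = schur S M' ws a b"
  using assms
proof (induction ws arbitrary: M M' a b)
  case (Cons w ws)
  have w: "M w i = M' w i" if "i \<in> set ws" for i
    using Cons.prems that by auto
  show ?case
  proof (cases "w \<in> S")
    case True
    have "schur S (\<lambda>x y. M x y + M w x * M w y) ws (\<lambda>i. a i + a w * M w i) (\<lambda>i. b i + b w * M w i) =
        schur S (\<lambda>x y. M x y + M w x * M w y) ws (\<lambda>i. a i + a w * M' w i) (\<lambda>i. b i + b w * M' w i)"
      by (rule schur_cong_vec) (simp_all add: w)
    also have "\<dots> = schur S (\<lambda>x y. M' x y + M' w x * M' w y) ws
        (\<lambda>i. a i + a w * M' w i) (\<lambda>i. b i + b w * M' w i)"
      by (rule Cons.IH) (use Cons.prems w in auto)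
    finally show ?thesis using True by simp
  next
    case False
    have "schur S M ws a b = schur S M' ws a b"
      by (rule Cons.IH) (use Cons.prems in auto)
    with False show ?thesis by simp
  qed
qed simp

text \<open>On \<open>S\<close> the vector \<open>a\<close> agrees with \<open>a + a\<close>, so by
  additivity the value equals its own double, which is 0.\<close>

lemma schur_zero_left:
  assumes "\<And>i. i \<in> S \<Longrightarrow> a i = 0"
  shows "schur S M ws a b = 0"
proof -
  have "schur S M ws a b = schur S M ws (\<lambda>i. a i + a i) b"
    by (rule schur_cong_vec) (simp_all only: assms bit_add_self)
  also have "\<dots> = schur S M ws a b + schur S M ws a b"
    by (rule schur_add_left)
  finally show ?thesis by (simp only: bit_add_self)
qed

text \<open>Induction on \<open>ws\<close>. If the updated vector is nonzero at a later vertex of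
  \<open>S\<close>, the inductive test vector works once its entry at the pivot is set to 0, which
  removes the pivot term and the update. Otherwise the pivot term alone survives, and
  \<open>a w = 1\<close>, since for \<open>a w = 0\<close> the update would leave \<open>a\<close>
  unchanged.\<close>

lemma schur_nondegenerate:
  assumes "distinct ws" "i \<in> S" "i \<in> set ws" "a i = 1"
  shows "\<exists>b. schur S M ws a b = 1"
  using assms
proof (induction ws arbitrary: M a i)
  case (Cons w ws)
  show ?case
  proof (cases "w \<in> S")
    case True
    define M' where "M' = (\<lambda>x y. M x y + M w x * M w y)"
    define a' where "a' = (\<lambda>i. a i + a w * M w i)"
    show ?thesis
    proof (cases "\<exists>k \<in> S \<inter> set ws. a' k = 1")
      case True2: True
      then obtain b where b: "schur S M' ws a' b = 1"
        using Cons.IH[of _ a' M'] Cons.prems by auto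
      define b' where "b' = b(w := 0)"
      have "schur S M' ws a' (\<lambda>i. b' i + b' w * M w i) = schur S M' ws a' b"
        using Cons.prems by (intro schur_cong_vec) (auto simp: b'_def)
      hence "schur S M (w # ws) a b' = 1"
        using True b by (simp add: M'_def a'_def b'_def)
      thus ?thesis by blast
    next
      case False
      have z: "schur S M' ws a' b = 0" for b
      proof -
        have "schur S M' ws a' b = schur S M' ws (\<lambda>_. 0) b"
          using False by (intro schur_cong_vec) auto
        thus ?thesis by (simp only: schur_zero_left)
      qed
      have "a w = 1"
      proof (rule ccontr)
        assume "a w \<noteq> 1"
        hence "a' = a" by (simp add: a'_def)
        moreover have "i \<noteq> w" using Cons.prems(4) \<open>a w \<noteq> 1\<close> by metis
        ultimately show False using False Cons.prems by auto
      qed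
      hence "schur S M (w # ws) a (\<lambda>i. of_bool (i = w)) = 1"
        using True z by (simp add: M'_def a'_def)
      thus ?thesis by blast
    qed
  next
    case False
    then show ?thesis using Cons.IH[of i a M] Cons.prems by auto
  qed
qed simp

lemma adj_eliminate:
  assumes "distinct ws" "set ws \<subseteq> verts G"
    "x \<in> verts G - set ws" "y \<in> verts G - set ws" "x \<noteq> y"
  shows "adj (eliminate S ws G) x y = adj G x y + schur S (adj G) ws (adj G x) (adj G y)"
  using assms
proof (induction ws arbitrary: G)
  case (Cons w ws)
  define G' where "G' = delete_vertex (if w \<in> S then local_complement G w else G) w"
  have IH: "adj (eliminate S ws G') x y = adj G' x y + schur S (adj G') ws (adj G' x) (adj G' y)"
    by (rule Cons.IH) (use Cons.prems in \<open>auto simp: G'_def\<close>)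
  show ?case
  proof (cases "w \<in> S")
    case True
    have G': "adj G' i j = adj G i j + adj G w i * adj G w j"
      if "i \<in> verts G - {w}" "j \<in> verts G - {w}" "i \<noteq> j" for i j
      using that True by (simp add: G'_def adj_delete_vertex adj_local_complement)
    have "schur S (adj G') ws (adj G' x) (adj G' y) =
        schur S (adj G') ws (\<lambda>i. adj G x i + adj G x w * adj G w i) (\<lambda>i. adj G y i + adj G y w * adj G w i)"
      by (rule schur_cong_vec; subst G')
         (use Cons.prems in \<open>auto simp: adj_commute[of G w x] adj_commute[of G w y]\<close>)
    \<comment> \<open>The rank one update alters the diagonal at neighbours of \<open>w\<close>,
      whereas local complementation creates no loops; agreement off the diagonal suffices.\<close>
    also have "\<dots> = schur S (\<lambda>i j. adj G i j + adj G w i * adj G w j) ws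
       (\<lambda>i. adj G x i + adj G x w * adj G w i) (\<lambda>i. adj G y i + adj G y w * adj G w i)"
      by (rule schur_cong_matrix) (use Cons.prems in \<open>auto intro!: G'\<close>)
    finally have "schur S (adj G') ws (adj G' x) (adj G' y) = \<dots>" .
    moreover have "adj G' x y = adj G x y + adj G x w * adj G y w"
      using Cons.prems by (subst G') (auto simp: adj_commute[of G w x] adj_commute[of G w y])
    ultimately show ?thesis
      using IH True by (simp add: G'_def)
  next
    case False
    have G': "adj G' i j = adj G i j" if "i \<noteq> w" "j \<noteq> w" for i j
      using that False by (simp add: G'_def adj_delete_vertex)
    have "schur S (adj G') ws (adj G' x) (adj G' y) = schur S (adj G') ws (adj G x) (adj G y)"
      by (rule schur_cong_vec) (use Cons.prems in \<open>auto intro!: G'\<close>)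
    also have "\<dots> = schur S (adj G) ws (adj G x) (adj G y)"
      by (rule schur_cong_matrix) (use Cons.prems in \<open>auto intro!: G'\<close>)
    finally show ?thesis
      using IH False G'[of x y] Cons.prems by (auto simp: G'_def)
  qed
qed simp

section \<open>Correlation of two elimination patterns\<close>

definition bit_sign :: "bit \<Rightarrow> real" where
  "bit_sign b = (if b = 1 then - 1 else 1)"

lemma bit_sign_0 [simp]: "bit_sign 0 = 1" and bit_sign_1 [simp]: "bit_sign 1 = - 1"
  by (simp_all add: bit_sign_def)

lemma bit_sign_add: "bit_sign (a + b) = bit_sign a * bit_sign b"
  by (cases a; cases b) simp_all

lemma bit_sign_sum: "bit_sign (\<Sum>i\<in>A. f i) = (\<Prod>i\<in>A. bit_sign (f i))"
  by (induction A rule: infinite_finite_induct) (simp_all add: bit_sign_add)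

lemma abs_bit_sign [simp]: "\<bar>bit_sign b\<bar> = 1"
  by (cases b) simp_all

lemma bit_sign_square: "(bit_sign b)\<^sup>2 = 1"
  by (cases b) simp_all

lemma schur_indicator_left:
  assumes "finite A"
  shows "schur S M ws (\<lambda>i. of_bool (i \<in> A)) b = (\<Sum>i\<in>A. schur S M ws (\<lambda>k. of_bool (k = i)) b)"
  using assms
proof (induction A rule: finite_induct)
  case empty
  show ?case by (simp add: schur_zero_left)
next
  case (insert i A)
  have "(\<lambda>k. of_bool (k \<in> insert i A)) = (\<lambda>k. of_bool (k = i) + (of_bool (k \<in> A) :: bit))"
    using insert.hyps by (auto simp: fun_eq_iff)
  thus ?case using insert by (simp add: schur_add_left)
qed

text \<open>The average factors over \<open>j\<close> into terms 1 or \<open>1 - 2 * p\<close>, and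
  the absolute value of the latter is \<open>1 - 2 * min p (1 - p)\<close>. This is the origin of
  the weight \<theta> in \<open>affine_image_weight_bound\<close>.\<close>

lemma bexp_sign_prod:
  assumes p: "0 \<le> p" "p \<le> 1" and "finite J"
  shows "\<bar>bexp p J (\<lambda>B. \<Prod>j\<in>B. bit_sign (z j))\<bar> =
    (\<Prod>j\<in>J. if z j = 1 then 1 - 2 * min p (1 - p) else 1)"
proof -
  have "bexp p J (\<lambda>B. \<Prod>j\<in>B. bit_sign (z j)) =
      bexp p J (\<lambda>B. \<Prod>j\<in>J. if j \<in> B then bit_sign (z j) else 1)"
    using assms(3) by (intro bexp_cong) (simp add: prod.If_cases Int_absorb1)
  also have "\<dots> = (\<Prod>j\<in>J. (1 - p) * 1 + p * bit_sign (z j))"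
    by (subst bexp_prod[OF assms(3), where f = "\<lambda>j t. if t then bit_sign (z j) else 1"]) simp
  also have "\<bar>\<dots>\<bar> = (\<Prod>j\<in>J. if z j = 1 then 1 - 2 * min p (1 - p) else 1)"
    unfolding abs_prod by (intro prod.cong) (auto simp: min_def bit_sign_def)
  finally show ?thesis .
qed

text \<open>Only the neighbourhoods \<open>A\<close> of \<open>x\<close> and \<open>B\<close> of
  \<open>y\<close> in \<open>W\<close> are averaged; all other edges are fixed. The exponent of the
  sign is then affine in \<open>B\<close>, with \<open>A\<close> entering the coefficients through
  the pair \<open>{x, y}\<close> alone. Averaging over \<open>B\<close> leaves a product of weights
  in \<open>A\<close>, which \<open>affine_image_weight_bound\<close> controls on
  \<open>S - S'\<close>.\<close>

lemma eliminate_correlation: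
  fixes p q :: real
  assumes p: "0 \<le> p" "p \<le> 1" and q: "q = min p (1 - p)"
    and U: "finite U" and ws: "distinct ws" "U \<inter> set ws = {}"
    and Q: "Q \<subseteq> nsets U 2" "{x, y} \<in> Q" and S: "S \<subseteq> set ws"
  shows "\<bar>bexp p (nsets (U \<union> set ws) 2) (\<lambda>F. bit_sign (\<Sum>e\<in>Q.
       of_bool (e \<in> edges (eliminate S ws (U \<union> set ws, F))) +
       of_bool (e \<in> edges (eliminate S' ws (U \<union> set ws, F)))))\<bar> \<le> (1 - 2 * q\<^sup>2) ^ card (S - S')"
    (is "\<bar>bexp p _ ?\<phi>\<bar> \<le> ?\<rho>")
proof -
  define W where "W = set ws"
  define V where "V = U \<union> W"
  have fin: "finite W" "finite V" "finite Q"
    using U finite_subset[OF Q(1)] by (auto simp: W_def V_def finite_imp_finite_nsets)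
  have UW: "u \<in> U \<Longrightarrow> u \<notin> W" for u
    using ws by (auto simp: W_def)
  have xy: "x \<noteq> y" "x \<in> U" "y \<in> U"
    using Q by (auto simp: nsets_def card_insert_if split: if_splits)
  define hx hy where "hx = (\<lambda>w. {x, w})" and "hy = (\<lambda>w. {y, w})"
  have inj: "inj_on hx W" "inj_on hy W"
    using xy UW by (auto simp: inj_on_def hx_def hy_def doubleton_eq_iff)
  \<comment> \<open>The edges kept fixed: all but those joining \<open>x\<close> or \<open>y\<close>
    to \<open>W\<close>. The pair \<open>{x, y}\<close> is among them.\<close>
  define D where "D = nsets V 2 - (hx ` W \<union> hy ` W)"
  have dec: "nsets V 2 = D \<union> (hx ` W \<union> hy ` W)"
    using xy UW by (auto simp: D_def nsets_def V_def hx_def hy_def card_insert_if)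
  have disj: "hx ` W \<inter> hy ` W = {}"
    using xy UW by (auto simp: hx_def hy_def doubleton_eq_iff)
  have finD: "finite D"
    using fin by (simp add: D_def finite_imp_finite_nsets)
  have key: "\<bar>bexp p W (\<lambda>A. bexp p W (\<lambda>B. ?\<phi> (F0 \<union> (hx ` A \<union> hy ` B))))\<bar> \<le> ?\<rho>"
    if F0: "F0 \<subseteq> D" for F0
  proof -
    define M where "M = adj (V, F0)"
    \<comment> \<open>\<open>R A B s\<close> is the row of \<open>s\<close> on \<open>W\<close> when
      \<open>A\<close> and \<open>B\<close> are the neighbourhoods of \<open>x\<close> and
      \<open>y\<close> there.\<close>
    define R :: "'a set \<Rightarrow> 'a set \<Rightarrow> 'a \<Rightarrow> 'a \<Rightarrow> bit" where
      "R = (\<lambda>A B s w. if s = x then of_bool (w \<in> A) else if s = y then of_bool (w \<in> B) else M s w)"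
    define \<gamma> where "\<gamma> = (\<lambda>a b. schur S M ws a b + schur S' M ws a b)"
    have \<gamma>_sum: "\<gamma> (\<lambda>i. of_bool (i \<in> A)) b = (\<Sum>i\<in>A. \<gamma> (\<lambda>k. of_bool (k = i)) b)"
      if "finite A" for A b
      using that by (simp add: \<gamma>_def schur_indicator_left sum.distrib)
    define unit :: "'a \<Rightarrow> 'a \<Rightarrow> bit" where "unit = (\<lambda>j k. of_bool (k = j))"
    have \<gamma>_sum_right: "\<gamma> b (\<lambda>i. of_bool (i \<in> A)) = (\<Sum>i\<in>A. \<gamma> b (unit i))" if "finite A" for A b
      unfolding \<gamma>_def schur_commute[of _ M ws b]
      using that by (simp add: schur_indicator_left sum.distrib unit_def)
    have \<gamma>_cong: "\<gamma> a b = \<gamma> a' b'" if "\<And>i. i \<in> W \<Longrightarrow> a i = a' i" "\<And>i. i \<in> W \<Longrightarrow> b i = b' i" for a b a' b'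
      unfolding \<gamma>_def using that by (intro arg_cong2[where f = "(+)"] schur_cong_vec) (auto simp: W_def)
    have elim: "of_bool ({s, t} \<in> edges (eliminate S ws (V, F0 \<union> (hx ` A \<union> hy ` B)))) +
        of_bool ({s, t} \<in> edges (eliminate S' ws (V, F0 \<union> (hx ` A \<union> hy ` B)))) =
        \<gamma> (R A B s) (R A B t)"
      if AB: "A \<subseteq> W" "B \<subseteq> W" and st: "s \<noteq> t" "s \<in> U" "t \<in> U" for A B s t
    proof -
      define G where "G = (V, F0 \<union> (hx ` A \<union> hy ` B))"
      have G: "adj G u w = R A B u w" if "u \<in> U" "w \<in> W" for u w
        using that xy UW F0 AB
        by (auto simp: G_def adj_def R_def M_def hx_def hy_def D_def doubleton_eq_iff)
      have GM: "adj G i j = M i j" if "i \<in> W" "j \<in> W" for i j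
        using that xy UW AB
        by (auto simp: G_def adj_def M_def hx_def hy_def doubleton_eq_iff)
      have sc: "schur Z (adj G) ws (adj G s) (adj G t) = schur Z M ws (R A B s) (R A B t)" for Z
      proof -
        have "schur Z (adj G) ws (adj G s) (adj G t) = schur Z M ws (adj G s) (adj G t)"
          using GM by (intro schur_cong_matrix ws) (auto simp: W_def)
        also have "\<dots> = schur Z M ws (R A B s) (R A B t)"
          using G st by (intro schur_cong_vec) (auto simp: W_def)
        finally show ?thesis .
      qed
      have "adj (eliminate Z ws G) s t = adj G s t + schur Z M ws (R A B s) (R A B t)" for Z
        unfolding sc[symmetric] using st UW
        by (intro adj_eliminate ws) (auto simp: G_def V_def W_def)
      \<comment> \<open>The original adjacency of \<open>s\<close> and \<open>t\<close> occurs in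
        both graphs and cancels.\<close>
      hence "adj (eliminate S ws G) s t + adj (eliminate S' ws G) s t = \<gamma> (R A B s) (R A B t)"
        by (simp add: \<gamma>_def ac_simps)
      thus ?thesis by (simp add: adj_def G_def)
    qed
    \<comment> \<open>Every pair in \<open>Q\<close> is oriented so that \<open>y\<close> is never
      its first end, and \<open>{x, y}\<close> runs from \<open>x\<close> to \<open>y\<close>. The
      set \<open>B\<close> can then enter only through second ends.\<close>
    have "\<forall>e\<in>Q. \<exists>s t. e = {s, t} \<and> s \<noteq> t \<and> s \<in> U \<and> t \<in> U \<and> s \<noteq> y \<and> (e = {x, y} \<longrightarrow> s = x \<and> t = y)"
    proof
      fix e assume "e \<in> Q"
      with Q(1) obtain a b where e: "e = {a, b}" "a \<noteq> b" "a \<in> U" "b \<in> U"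
        by (auto simp: nsets_def card_2_iff)
      show "\<exists>s t. e = {s, t} \<and> s \<noteq> t \<and> s \<in> U \<and> t \<in> U \<and> s \<noteq> y \<and> (e = {x, y} \<longrightarrow> s = x \<and> t = y)"
      proof (cases "a = y")
        case True
        thus ?thesis using e by (intro exI[of _ b] exI[of _ a]) (auto simp: doubleton_eq_iff)
      next
        case False
        show ?thesis
        proof (cases "e = {x, y}")
          case True
          thus ?thesis using xy by (intro exI[of _ x] exI[of _ y]) auto
        next
          case False
          thus ?thesis using e \<open>a \<noteq> y\<close> by (intro exI[of _ a] exI[of _ b]) auto
        qed
      qed
    qed
    then obtain s t where st: "\<And>e. e \<in> Q \<Longrightarrow> e = {s e, t e} \<and> s e \<noteq> t e \<and> s e \<in> U \<and> t e \<in> U \<and>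
        s e \<noteq> y \<and> (e = {x, y} \<longrightarrow> s e = x \<and> t e = y)"
      by metis
    define Q1 where "Q1 = {e \<in> Q. t e = y}"
    define Q2 where "Q2 = {e \<in> Q. t e \<noteq> y}"
    have Q12: "Q = Q1 \<union> Q2" "Q1 \<inter> Q2 = {}" "finite Q1" "finite Q2" "{x, y} \<in> Q1"
      using fin Q(2) st[OF Q(2)] by (auto simp: Q1_def Q2_def)
    \<comment> \<open>\<open>c\<close> couples \<open>A\<close> with \<open>B\<close> through the
      pair \<open>{x, y}\<close>, \<open>h\<close> collects the other pairs of \<open>Q\<close> at
      \<open>y\<close>, which do not involve \<open>A\<close>, and \<open>\<kappa>\<close> collects
      the pairs avoiding \<open>y\<close>, which do not involve \<open>B\<close>.\<close>
    define c where "c = (\<lambda>i j. \<gamma> (unit i) (unit j))"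
    define h where "h = (\<lambda>j. \<Sum>e\<in>Q1 - {{x, y}}. \<gamma> (M (s e)) (unit j))"
    define \<kappa> where "\<kappa> = (\<lambda>A. \<Sum>e\<in>Q2. \<gamma> (R A {} (s e)) (R A {} (t e)))"
    have \<phi>: "?\<phi> (F0 \<union> (hx ` A \<union> hy ` B)) =
        bit_sign (\<kappa> A) * (\<Prod>j\<in>B. bit_sign (h j + (\<Sum>i\<in>A. c i j)))" if AB: "A \<subseteq> W" "B \<subseteq> W" for A B
    proof -
      have finAB: "finite A" "finite B" using AB fin finite_subset by auto
      have "(\<Sum>e\<in>Q. of_bool (e \<in> edges (eliminate S ws (V, F0 \<union> (hx ` A \<union> hy ` B)))) +
          of_bool (e \<in> edges (eliminate S' ws (V, F0 \<union> (hx ` A \<union> hy ` B))))) =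
          (\<Sum>e\<in>Q. \<gamma> (R A B (s e)) (R A B (t e)))"
      proof (rule sum.cong[OF HOL.refl])
        fix e assume "e \<in> Q"
        note st = st[OF this]
        show "of_bool (e \<in> edges (eliminate S ws (V, F0 \<union> (hx ` A \<union> hy ` B)))) +
          of_bool (e \<in> edges (eliminate S' ws (V, F0 \<union> (hx ` A \<union> hy ` B)))) =
          \<gamma> (R A B (s e)) (R A B (t e))"
          using elim[OF AB, of "s e" "t e"] st by simp
      qed
      also have "\<dots> = (\<Sum>e\<in>Q2. \<gamma> (R A B (s e)) (R A B (t e))) + (\<Sum>e\<in>Q1. \<gamma> (R A B (s e)) (R A B (t e)))"
        using Q12 by (simp add: sum.union_disjoint add.commute)
      also have "(\<Sum>e\<in>Q2. \<gamma> (R A B (s e)) (R A B (t e))) = \<kappa> A"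
        unfolding \<kappa>_def
      proof (rule sum.cong[OF HOL.refl])
        fix e assume "e \<in> Q2"
        hence "s e \<noteq> y" "t e \<noteq> y" using st by (auto simp: Q2_def)
        hence "R A B (s e) = R A {} (s e)" "R A B (t e) = R A {} (t e)"
          by (auto simp: R_def fun_eq_iff)
        thus "\<gamma> (R A B (s e)) (R A B (t e)) = \<gamma> (R A {} (s e)) (R A {} (t e))"
          by simp
      qed
      also have "(\<Sum>e\<in>Q1. \<gamma> (R A B (s e)) (R A B (t e))) =
          (\<Sum>e\<in>Q1. \<Sum>j\<in>B. \<gamma> (R A B (s e)) (unit j))"
      proof (rule sum.cong[OF HOL.refl])
        fix e assume "e \<in> Q1"
        hence "R A B (t e) = (\<lambda>w. of_bool (w \<in> B))"
          using xy by (auto simp: Q1_def R_def)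
        thus "\<gamma> (R A B (s e)) (R A B (t e)) = (\<Sum>j\<in>B. \<gamma> (R A B (s e)) (unit j))"
          using \<gamma>_sum_right[OF finAB(2), of "R A B (s e)"] by simp
      qed
      also have "\<dots> = (\<Sum>j\<in>B. \<Sum>e\<in>Q1. \<gamma> (R A B (s e)) (unit j))"
        by (rule sum.swap)
      also have "\<dots> = (\<Sum>j\<in>B. h j + (\<Sum>i\<in>A. c i j))"
      proof (rule sum.cong[OF HOL.refl])
        fix j assume "j \<in> B"
        have "(\<Sum>e\<in>Q1. \<gamma> (R A B (s e)) (unit j)) = \<gamma> (R A B (s {x, y})) (unit j) +
            (\<Sum>e\<in>Q1 - {{x, y}}. \<gamma> (R A B (s e)) (unit j))"
          using Q12 by (intro sum.remove) auto
        also have "R A B (s {x, y}) = (\<lambda>w. of_bool (w \<in> A))"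
          using st[OF Q(2)] by (auto simp: R_def fun_eq_iff)
        also have "\<gamma> (\<lambda>w. of_bool (w \<in> A)) (unit j) = (\<Sum>i\<in>A. c i j)"
          using \<gamma>_sum[OF finAB(1), of "unit j"] by (simp add: c_def unit_def)
        also have "(\<Sum>e\<in>Q1 - {{x, y}}. \<gamma> (R A B (s e)) (unit j)) = h j"
          unfolding h_def
        proof (rule sum.cong[OF HOL.refl])
          fix e assume e: "e \<in> Q1 - {{x, y}}"
          hence "e = {s e, y}" "s e \<noteq> y" using st[of e] by (auto simp: Q1_def)
          hence "s e \<noteq> x" "s e \<noteq> y" using e by auto
          hence "R A B (s e) = M (s e)"
            by (auto simp: R_def fun_eq_iff)
          thus "\<gamma> (R A B (s e)) (unit j) = \<gamma> (M (s e)) (unit j)"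
            by simp
        qed
        finally show "(\<Sum>e\<in>Q1. \<gamma> (R A B (s e)) (unit j)) = h j + (\<Sum>i\<in>A. c i j)"
          by (simp add: add.commute)
      qed
      finally show ?thesis
        unfolding V_def W_def by (simp only: bit_sign_add bit_sign_sum)
    qed
    \<comment> \<open>The form for \<open>S'\<close> vanishes on vectors supported in
      \<open>S - S'\<close>, so on these \<open>\<gamma>\<close> is the form for \<open>S\<close>,
      which is nondegenerate. Expanding a test vector into unit vectors yields
      \<open>j\<close>.\<close>
    have indep: "\<exists>j\<in>W. (\<Sum>i\<in>T. c i j) = 1" if T: "T \<subseteq> S - S'" "T \<noteq> {}" for T
    proof -
      have finT: "finite T" using T S fin finite_subset[of T W] by (auto simp: W_def)
      define a where "a = (\<lambda>i. of_bool (i \<in> T) :: bit)"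
      obtain i where i: "i \<in> T" using T by auto
      have "\<exists>b. schur S M ws a b = 1"
        using i T S by (intro schur_nondegenerate[of ws i] ws) (auto simp: a_def)
      then obtain b where b: "schur S M ws a b = 1" by blast
      have "schur S' M ws a d = 0" for d
        using T by (intro schur_zero_left) (auto simp: a_def)
      hence \<gamma>a: "\<gamma> a d = schur S M ws a d" for d
        by (simp add: \<gamma>_def)
      define B where "B = {j \<in> W. b j = 1}"
      have "\<gamma> a (\<lambda>k. of_bool (k \<in> B)) = \<gamma> a b"
        by (rule \<gamma>_cong) (auto simp: B_def)
      also have "\<gamma> a b = 1"
        using \<gamma>a b by simp
      finally have sum1: "(\<Sum>j\<in>B. \<gamma> a (unit j)) = 1"
        using \<gamma>_sum_right[of B a] fin by (simp add: B_def)
      have "\<exists>j\<in>B. \<gamma> a (unit j) = 1"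
      proof (rule ccontr)
        assume "\<not> ?thesis"
        hence "(\<Sum>j\<in>B. \<gamma> a (unit j)) = 0"
          by (intro sum.neutral) auto
        thus False using sum1 by simp
      qed
      then obtain j where j: "j \<in> B" "\<gamma> a (unit j) = 1"
        by blast
      hence "(\<Sum>i\<in>T. c i j) = 1"
        using \<gamma>_sum[OF finT, of "unit j"] by (simp add: a_def c_def unit_def)
      thus ?thesis using j by (auto simp: B_def)
    qed
    have "bexp p W (\<lambda>A. bexp p W (\<lambda>B. ?\<phi> (F0 \<union> (hx ` A \<union> hy ` B)))) =
        bexp p W (\<lambda>A. bit_sign (\<kappa> A) * bexp p W (\<lambda>B. \<Prod>j\<in>B. bit_sign (h j + (\<Sum>i\<in>A. c i j))))"
      unfolding bexp_cmult[symmetric] by (intro bexp_cong \<phi>)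
    hence "\<bar>bexp p W (\<lambda>A. bexp p W (\<lambda>B. ?\<phi> (F0 \<union> (hx ` A \<union> hy ` B))))\<bar> \<le>
        bexp p W (\<lambda>A. \<bar>bit_sign (\<kappa> A) * bexp p W (\<lambda>B. \<Prod>j\<in>B. bit_sign (h j + (\<Sum>i\<in>A. c i j)))\<bar>)"
      using bexp_abs_le[OF p] by simp
    also have "\<dots> = bexp p W (\<lambda>A. \<Prod>j\<in>W. if h j + (\<Sum>i\<in>A. c i j) = 1 then 1 - 2 * q else 1)"
      unfolding abs_mult abs_bit_sign bexp_sign_prod[OF p fin(1)] q by simp
    \<comment> \<open>Independence of the rows of \<open>c\<close> is available on
      \<open>S - S'\<close>. The rest of \<open>A\<close> is conditioned on and merely shifts the
      constant part of the affine map.\<close>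
    also have "\<dots> = bexp p ((W - (S - S')) \<union> (S - S'))
        (\<lambda>A. \<Prod>j\<in>W. if h j + (\<Sum>i\<in>A. c i j) = 1 then 1 - 2 * q else 1)"
      using S by (simp add: W_def Un_absorb2 Diff_subset_conv le_supI1 le_supI2)
    also have "\<dots> = bexp p (W - (S - S')) (\<lambda>A2. bexp p (S - S') (\<lambda>A1.
        \<Prod>j\<in>W. if h j + (\<Sum>i\<in>A2 \<union> A1. c i j) = 1 then 1 - 2 * q else 1))"
      using fin S finite_subset[of S W] by (intro bexp_union) (auto simp: W_def)
    also have "\<dots> \<le> ?\<rho>"
    proof (rule bexp_le_const[OF p])
      fix A2 assume A2: "A2 \<subseteq> W - (S - S')"
      have finS: "finite S" using S finite_subset by auto
      have "bexp p (S - S') (\<lambda>A1. \<Prod>j\<in>W. if h j + (\<Sum>i\<in>A2 \<union> A1. c i j) = 1 then 1 - 2 * q else 1) =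
         bexp p (S - S') (\<lambda>A1. \<Prod>j\<in>W. if (h j + (\<Sum>i\<in>A2. c i j)) + (\<Sum>i\<in>A1. c i j) = 1 then 1 - 2 * q else 1)"
      proof (rule bexp_cong)
        fix A1 assume A1: "A1 \<subseteq> S - S'"
        have "finite A2" "finite A1" "A2 \<inter> A1 = {}"
          using A1 A2 fin finS finite_subset[of A2 W] finite_subset[of A1 S] by auto
        thus "(\<Prod>j\<in>W. if h j + (\<Sum>i\<in>A2 \<union> A1. c i j) = 1 then 1 - 2 * q else 1) =
          (\<Prod>j\<in>W. if (h j + (\<Sum>i\<in>A2. c i j)) + (\<Sum>i\<in>A1. c i j) = 1 then 1 - 2 * q else 1)"
          by (simp add: sum.union_disjoint add.assoc)
      qed
      also have "\<dots> \<le> ?\<rho>"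
        using finS fin indep by (intro affine_image_weight_bound[OF p q]) auto
      finally show "bexp p (S - S') (\<lambda>A1. \<Prod>j\<in>W. if h j + (\<Sum>i\<in>A2 \<union> A1. c i j) = 1 then 1 - 2 * q else 1) \<le> ?\<rho>" .
    qed (use fin in auto)
    finally show ?thesis .
  qed
  have "bexp p (nsets V 2) ?\<phi> =
      bexp p D (\<lambda>F0. bexp p (hx ` W \<union> hy ` W) (\<lambda>X. ?\<phi> (F0 \<union> X)))"
    unfolding dec using finD fin by (intro bexp_union) (auto simp: D_def)
  also have "\<dots> = bexp p D (\<lambda>F0. bexp p (hx ` W) (\<lambda>X. bexp p (hy ` W) (\<lambda>Y. ?\<phi> (F0 \<union> (X \<union> Y)))))"
    using fin disj by (subst bexp_union) auto
  also have "\<dots> = bexp p D (\<lambda>F0. bexp p W (\<lambda>A. bexp p W (\<lambda>B. ?\<phi> (F0 \<union> (hx ` A \<union> hy ` B)))))"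
    using fin by (simp add: bexp_image inj)
  finally have "bexp p (nsets V 2) ?\<phi> = \<dots>" .
  moreover have "\<bar>bexp p D (\<lambda>F0. bexp p W (\<lambda>A. bexp p W (\<lambda>B. ?\<phi> (F0 \<union> (hx ` A \<union> hy ` B)))))\<bar> \<le> ?\<rho>"
    by (rule order_trans[OF bexp_abs_le[OF p]], rule bexp_le_const[OF p finD]) (rule key)
  ultimately show ?thesis
    unfolding V_def W_def by simp
qed

section \<open>The second moment bound\<close>

text \<open>The Walsh character: for finite \<open>Q\<close> its value is -1 to the power of the
  size of \<open>Q \<inter> X\<close>.\<close>

definition character :: "'a set \<Rightarrow> 'a set \<Rightarrow> real" where
  "character Q X = bit_sign (\<Sum>e\<in>Q. of_bool (e \<in> X))"

text \<open>Orthogonality of characters: the sum factors over \<open>P\<close>, and an element in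
  exactly one of \<open>X\<close> and \<open>Y\<close> contributes the factor
  \<open>- 1 + 1\<close>.\<close>

lemma sum_character_distinct:
  assumes "finite P" "X \<subseteq> P" "Y \<subseteq> P" "X \<noteq> Y"
  shows "(\<Sum>Q\<in>Pow P. character Q X * character Q Y) = 0"
proof -
  obtain e where e: "e \<in> P" "e \<in> X \<longleftrightarrow> e \<notin> Y"
    using assms by blast
  have "(\<Sum>Q\<in>Pow P. character Q X * character Q Y) =
      (\<Sum>Q\<in>Pow P. (\<Prod>e\<in>Q. bit_sign (of_bool (e \<in> X)) * bit_sign (of_bool (e \<in> Y))) * (\<Prod>e\<in>P - Q. 1))"
    by (simp add: character_def bit_sign_sum prod.distrib)
  also have "\<dots> = (\<Prod>e\<in>P. bit_sign (of_bool (e \<in> X)) * bit_sign (of_bool (e \<in> Y)) + 1)"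
    by (rule prod_add[OF assms(1), symmetric])
  also have "\<dots> = 0"
    by (rule prod_zero[OF assms(1)]) (use e in \<open>auto intro!: bexI[of _ e]\<close>)
  finally show ?thesis .
qed

text \<open>Each \<open>w\<close> lies in \<open>S - S'\<close> with probability 1/4, independently
  of the others.\<close>

lemma average_overlap:
  assumes "finite W"
  shows "bexp (1 / 2) W (\<lambda>S'. bexp (1 / 2) W (\<lambda>S. \<rho> ^ card (S - S'))) = (3 / 4 + \<rho> / 4) ^ card W"
proof -
  have "bexp (1 / 2) W (\<lambda>S'. bexp (1 / 2) W (\<lambda>S. \<rho> ^ card (S - S'))) =
      bexp (1 / 2) W (\<lambda>S'. bexp (1 / 2) W (\<lambda>S. \<Prod>w\<in>W. if w \<in> S \<and> w \<notin> S' then \<rho> else 1))"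
  proof (intro bexp_cong)
    fix S S' assume "S \<subseteq> W"
    hence "W \<inter> {w. w \<in> S \<and> w \<notin> S'} = S - S'" by auto
    thus "\<rho> ^ card (S - S') = (\<Prod>w\<in>W. if w \<in> S \<and> w \<notin> S' then \<rho> else 1)"
      using assms by (simp add: prod.If_cases)
  qed
  also have "\<dots> = bexp (1 / 2) W (\<lambda>S'. \<Prod>w\<in>W. 1 / 2 + (if w \<in> S' then 1 else \<rho>) / 2)"
    by (subst bexp_prod[OF assms, where f = "\<lambda>w t. if t \<and> w \<notin> _ then \<rho> else 1"])
       (auto intro!: bexp_cong prod.cong)
  also have "\<dots> = (3 / 4 + \<rho> / 4) ^ card W"
    by (subst bexp_prod[OF assms, where f = "\<lambda>w t. 1 / 2 + (if t then 1 else \<rho>) / 2"])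
       (simp add: field_simps)
  finally show ?thesis .
qed

text \<open>If no \<open>S\<close> produces \<open>H\<close>, the nontrivial Fourier coefficients
  must cancel the trivial one, which is 1, so by Cauchy-Schwarz their squares have sum at least
  \<open>1 / card N\<close>. The correlation bound makes each square small on average. One factor
  \<open>2 ^ card P\<close> comes from Cauchy-Schwarz, the other from the number of
  coefficients.\<close>

lemma vertex_minors_on_set_bound:
  fixes p q :: real
  assumes p: "0 \<le> p" "p \<le> 1" and q: "q = min p (1 - p)" and V: "finite V" "U \<subseteq> V"
  shows "bexp p (nsets V 2)
      (\<lambda>F. of_bool (\<exists>H. simple_graph H \<and> verts H = U \<and> \<not> has_vertex_minor (V, F) H))
    \<le> 4 ^ card (nsets U 2) * (1 - q\<^sup>2 / 2) ^ card (V - U)"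
proof -
  define W where "W = V - U"
  have finW: "finite W" and finU: "finite U"
    using V finite_subset by (auto simp: W_def)
  obtain ws where ws: "set ws = W" "distinct ws"
    using finite_distinct_list[OF finW] by blast
  have UW: "U \<union> set ws = V" "U \<inter> set ws = {}"
    using V ws by (auto simp: W_def)
  define P where "P = nsets U 2"
  have finP: "finite P" using finU by (simp add: P_def finite_imp_finite_nsets)
  define N where "N = Pow P - {{}}"
  have finN: "finite N" using finP by (simp add: N_def)
  have cardN: "real (card N) \<le> 2 ^ card P"
    using finP card_mono[of "Pow P" N] by (simp add: N_def card_Pow)
  define ES where "ES = (\<lambda>S F. edges (eliminate S ws (V, F)))"
  \<comment> \<open>The Fourier coefficient at \<open>Q\<close> of the distribution of the
    eliminated graph for uniformly random \<open>S\<close>.\<close>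
  define Y where "Y = (\<lambda>Q F. bexp (1 / 2) W (\<lambda>S. character Q (ES S F)))"
  have pointwise: "of_bool (\<exists>H. simple_graph H \<and> verts H = U \<and> \<not> has_vertex_minor (V, F) H)
      \<le> 2 ^ card P * (\<Sum>Q\<in>N. (Y Q F)\<^sup>2)" if F: "F \<subseteq> nsets V 2" for F
  proof (cases "\<exists>H. simple_graph H \<and> verts H = U \<and> \<not> has_vertex_minor (V, F) H")
    case True
    then obtain H where H: "simple_graph H" "verts H = U" "\<not> has_vertex_minor (V, F) H"
      by blast
    have HP: "edges H \<subseteq> P" using H by (simp add: simple_graph_def P_def)
    have sG: "simple_graph (V, F)" using F V by (simp add: simple_graph_def)
    have vS: "verts (eliminate S ws (V, F)) = U" for S
      using ws V by (auto simp: W_def)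
    have ESP: "ES S F \<subseteq> P" for S
      using simple_graph_eliminate[OF sG, of S ws] vS[of S] by (simp add: simple_graph_def P_def ES_def)
    have ne: "edges H \<noteq> ES S F" for S
    proof
      assume "edges H = ES S F"
      hence "eliminate S ws (V, F) = H"
        using H(2) vS[of S] by (simp add: ES_def prod_eq_iff)
      moreover have "has_vertex_minor (V, F) (eliminate S ws (V, F))"
        using ws by (intro has_vertex_minor_eliminate has_vertex_minor.refl) (auto simp: W_def)
      ultimately show False using H(3) by simp
    qed
    \<comment> \<open>Fourier inversion at \<open>H\<close>: the edge set of \<open>H\<close>
      differs from every \<open>ES S F\<close>, so orthogonality makes each inner sum
      vanish.\<close>
    have "0 = bexp (1 / 2) W (\<lambda>S. \<Sum>Q\<in>Pow P. character Q (edges H) * character Q (ES S F))"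
      using sum_character_distinct[OF finP HP ESP ne] bexp_const[OF finW, of "1/2" 0] by simp
    also have "\<dots> = (\<Sum>Q\<in>Pow P. character Q (edges H) * Y Q F)"
      by (simp add: bexp_sum bexp_cmult Y_def)
    also have "\<dots> = character {} (edges H) * Y {} F + (\<Sum>Q\<in>N. character Q (edges H) * Y Q F)"
      unfolding N_def using finP by (intro sum.remove) auto
    also have "character {} (edges H) * Y {} F = 1"
      using bexp_const[OF finW, of "1/2" 1] by (simp add: character_def Y_def)
    finally have m1: "(\<Sum>Q\<in>N. character Q (edges H) * Y Q F) = - 1" by simp
    have "1 = (\<Sum>Q\<in>N. character Q (edges H) * Y Q F)\<^sup>2"
      by (simp add: m1)
    also have "\<dots> \<le> (\<Sum>Q\<in>N. (character Q (edges H))\<^sup>2) * (\<Sum>Q\<in>N. (Y Q F)\<^sup>2)"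
      by (rule Cauchy_Schwarz_ineq_sum)
    also have "(\<Sum>Q\<in>N. (character Q (edges H))\<^sup>2) = real (card N)"
      by (simp add: character_def bit_sign_square)
    also have "real (card N) * (\<Sum>Q\<in>N. (Y Q F)\<^sup>2) \<le> 2 ^ card P * (\<Sum>Q\<in>N. (Y Q F)\<^sup>2)"
      using cardN by (intro mult_right_mono) (auto intro: sum_nonneg)
    finally show ?thesis using True by simp
  next
    case False
    have "0 \<le> 2 ^ card P * (\<Sum>Q\<in>N. (Y Q F)\<^sup>2)"
      by (intro mult_nonneg_nonneg sum_nonneg) auto
    thus ?thesis by (simp only: False of_bool_eq)
  qed
  have second: "bexp p (nsets V 2) (\<lambda>F. (Y Q F)\<^sup>2) \<le> (1 - q\<^sup>2 / 2) ^ card W" if Q: "Q \<in> N" for Q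
  proof -
    obtain e where e: "e \<in> Q" "Q \<subseteq> nsets U 2"
      using Q by (auto simp: N_def P_def)
    then obtain x y where xy: "{x, y} \<in> Q"
      by (auto simp: nsets_def card_2_iff)
    \<comment> \<open>The square becomes an average over two independent copies of \<open>S\<close>,
      which brings in the pair correlations.\<close>
    have "(Y Q F)\<^sup>2 = bexp (1 / 2) W (\<lambda>S'. bexp (1 / 2) W (\<lambda>S. character Q (ES S' F) * character Q (ES S F)))" for F
      by (simp only: bexp_cmult bexp_multc Y_def power2_eq_square)
    hence "bexp p (nsets V 2) (\<lambda>F. (Y Q F)\<^sup>2) =
        bexp (1 / 2) W (\<lambda>S'. bexp (1 / 2) W (\<lambda>S.
          bexp p (nsets V 2) (\<lambda>F. character Q (ES S' F) * character Q (ES S F))))"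
      by (simp add: bexp_commute[of p])
    also have "\<dots> \<le> bexp (1 / 2) W (\<lambda>S'. bexp (1 / 2) W (\<lambda>S. (1 - 2 * q\<^sup>2) ^ card (S - S')))"
    proof (intro bexp_mono)
      fix S' S assume "S' \<subseteq> W" "S \<subseteq> W"
      have "bexp p (nsets V 2) (\<lambda>F. character Q (ES S' F) * character Q (ES S F)) =
        bexp p (nsets (U \<union> set ws) 2) (\<lambda>F. bit_sign (\<Sum>e\<in>Q.
         of_bool (e \<in> edges (eliminate S ws (U \<union> set ws, F))) +
         of_bool (e \<in> edges (eliminate S' ws (U \<union> set ws, F)))))"
        unfolding UW by (simp add: sum.distrib bit_sign_add character_def ES_def mult.commute)
      moreover have "\<dots> \<le> (1 - 2 * q\<^sup>2) ^ card (S - S')"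
        using \<open>S \<subseteq> W\<close> ws
        by (intro order_trans[OF abs_ge_self eliminate_correlation[OF p q finU ws(2) UW(2) e(2) xy]]) simp
      ultimately show "bexp p (nsets V 2) (\<lambda>F. character Q (ES S' F) * character Q (ES S F))
          \<le> (1 - 2 * q\<^sup>2) ^ card (S - S')" by simp
    qed auto
    \<comment> \<open>The base is \<open>3 / 4 + (1 - 2 * q\<^sup>2) / 4\<close>.\<close>
    also have "\<dots> = (1 - q\<^sup>2 / 2) ^ card W"
      by (subst average_overlap[OF finW], rule arg_cong[where f = "\<lambda>t. t ^ card W"]) (simp add: field_simps)
    finally show ?thesis .
  qed
  have q2: "0 \<le> 1 - q\<^sup>2 / 2"
  proof -
    have "q\<^sup>2 \<le> 1\<^sup>2" using p q by (intro power_mono) (auto simp: min_def)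
    thus ?thesis by simp
  qed
  have "bexp p (nsets V 2) (\<lambda>F. of_bool (\<exists>H. simple_graph H \<and> verts H = U \<and> \<not> has_vertex_minor (V, F) H))
      \<le> bexp p (nsets V 2) (\<lambda>F. 2 ^ card P * (\<Sum>Q\<in>N. (Y Q F)\<^sup>2))"
    by (intro bexp_mono p pointwise)
  also have "\<dots> = 2 ^ card P * (\<Sum>Q\<in>N. bexp p (nsets V 2) (\<lambda>F. (Y Q F)\<^sup>2))"
    by (simp add: bexp_cmult bexp_sum)
  also have "\<dots> \<le> 2 ^ card P * (\<Sum>Q\<in>N. (1 - q\<^sup>2 / 2) ^ card W)"
    by (intro mult_left_mono sum_mono second) auto
  also have "\<dots> \<le> 2 ^ card P * (2 ^ card P * (1 - q\<^sup>2 / 2) ^ card W)"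
    using cardN q2 by (auto intro!: mult_right_mono)
  also have "\<dots> = 4 ^ card P * (1 - q\<^sup>2 / 2) ^ card W"
    using power_mult_distrib[of "2::real" 2 "card P"] by simp
  finally show ?thesis by (simp add: P_def W_def)
qed

section \<open>Numerical estimate\<close>

lemma exponent_bound:
  fixes q :: real
  assumes "0 \<le> q" "q \<le> 1 / 2" "n > 0" "q \<ge> 100 * ln (real n) / sqrt (real n)"
    and k: "real k \<le> q * sqrt (real n) / 100" and "k \<le> n"
  shows "real (n ^ k) * (2 ^ (k\<^sup>2) * (1 - q\<^sup>2 / 2) ^ (n - k)) \<le> 2 powr (- (q\<^sup>2 * real n / 100))"
proof -
  \<comment> \<open>All exponents are measured in units of \<open>Q\<close>. Both
    \<open>ln n\<close> and \<open>k\<close> are at most \<open>q * sqrt n / 100\<close>, so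
    \<open>k * ln n\<close> and \<open>k\<^sup>2\<close> are at most
    \<open>Q / 10000\<close>.\<close>
  define Q where "Q = q\<^sup>2 * real n"
  have sq: "sqrt (real n) * sqrt (real n) = real n" by simp
  have s1: "1 \<le> sqrt (real n)" using assms(3) by simp
  have l: "ln (real n) \<le> q * sqrt (real n) / 100"
    using assms(3,4) by (simp add: field_simps)
  have QQ: "(q * sqrt (real n) / 100) * (q * sqrt (real n) / 100) = Q / 10000"
    using sq by (simp add: Q_def power2_eq_square algebra_simps)
  have "real k * ln (real n) \<le> (q * sqrt (real n) / 100) * (q * sqrt (real n) / 100)"
    using k l assms(1,3) by (intro mult_mono) auto
  hence 1: "real k * ln (real n) \<le> Q / 10000" using QQ by simp
  have "real k * real k \<le> (q * sqrt (real n) / 100) * (q * sqrt (real n) / 100)"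
    using k assms(1) by (intro mult_mono) auto
  hence 2: "real (k\<^sup>2) \<le> Q / 10000" using QQ by (simp add: power2_eq_square)
  have "q * sqrt (real n) \<le> 1 / 2 * (sqrt (real n) * sqrt (real n))"
    using mult_mono[OF assms(2) mult_right_mono[OF s1, of "sqrt (real n)"]] by simp
  \<comment> \<open>Replacing \<open>n\<close> by \<open>n - k\<close> in the decay therefore costs
    only \<open>Q / 400\<close>.\<close>
  hence "real k \<le> real n / 200" using k sq by simp
  hence "q\<^sup>2 * real k \<le> q\<^sup>2 * (real n / 200)" by (intro mult_left_mono) auto
  hence 3: "q\<^sup>2 / 2 * real (n - k) \<ge> Q / 2 - Q / 400"
    using assms(6) by (simp add: Q_def of_nat_diff algebra_simps)
  have Q0: "0 \<le> Q" by (simp add: Q_def)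
  have q2: "0 \<le> 1 - q\<^sup>2 / 2"
  proof -
    have "q\<^sup>2 \<le> 1\<^sup>2" using assms by (intro power_mono) auto
    thus ?thesis by simp
  qed
  have ln2: "0 \<le> ln (2::real)" "ln (2::real) \<le> 1"
    using ln_le_minus_one[of "2::real"] by auto
  have A: "real (n ^ k) = exp (real k * ln (real n))"
    using assms(3) by (simp add: exp_of_nat_mult)
  have "(2::real) ^ (k\<^sup>2) = exp (real (k\<^sup>2) * ln 2)"
    by (simp only: exp_of_nat_mult exp_ln zero_less_numeral)
  also have "\<dots> \<le> exp (real (k\<^sup>2))"
    using ln2 mult_left_mono[of "ln 2" 1 "real (k\<^sup>2)"] by simp
  finally have B: "(2::real) ^ (k\<^sup>2) \<le> exp (real (k\<^sup>2))" .
  have "(1 - q\<^sup>2 / 2) ^ (n - k) \<le> exp (- (q\<^sup>2 / 2)) ^ (n - k)"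
    using exp_ge_add_one_self[of "- (q\<^sup>2 / 2)"] q2 by (intro power_mono) auto
  also have "\<dots> = exp (- (q\<^sup>2 / 2 * real (n - k)))"
    unfolding exp_of_nat_mult[symmetric] by (simp add: mult.commute)
  finally have C: "(1 - q\<^sup>2 / 2) ^ (n - k) \<le> exp (- (q\<^sup>2 / 2 * real (n - k)))" .
  have "real (n ^ k) * (2 ^ (k\<^sup>2) * (1 - q\<^sup>2 / 2) ^ (n - k)) \<le>
      exp (real k * ln (real n)) * (exp (real (k\<^sup>2)) * exp (- (q\<^sup>2 / 2 * real (n - k))))"
    unfolding A using B C q2 by (intro mult_mono) auto
  also have "\<dots> = exp (real k * ln (real n) + real (k\<^sup>2) - q\<^sup>2 / 2 * real (n - k))"
    by (simp add: exp_add[symmetric])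
  \<comment> \<open>The exponent is at most \<open>Q / 5000 + Q / 400 - Q / 2\<close>.\<close>
  also have "\<dots> \<le> exp (- (Q / 100))"
    using 1 2 3 Q0 by (subst exp_le_cancel_iff) linarith
  also have "\<dots> \<le> exp (- (Q / 100) * ln 2)"
    using ln2 Q0 mult_left_mono[of "ln 2" 1 Q] by simp
  also have "\<dots> = 2 powr (- (q\<^sup>2 * real n / 100))"
    by (simp add: powr_def Q_def)
  finally show ?thesis .
qed

section \<open>Union bound over the vertex sets of size \<open>k\<close>\<close>

theorem theorem1p3:
  "\<exists>n0::nat. \<forall>n::nat. n > n0 \<longrightarrow>
     (\<forall>(p::real) (q::real) (k::nat).
        0 \<le> p \<and> p \<le> 1 \<and> q = min p (1 - p) \<and>
        q \<ge> 100 * ln (real n) / sqrt (real n) \<and>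
        0 < k \<and> real k \<le> q * sqrt (real n) / 100 \<longrightarrow>
        measure_pmf.prob (random_graph n p) {G. vertex_minor_universal k G}
          \<ge> 1 - 2 powr (- (q\<^sup>2 * real n / 100)))"
\<comment> \<open>The numerical estimate is valid for every positive \<open>n\<close>, so
  \<open>n0 = 0\<close> serves.\<close>
proof (intro exI[of _ 0] allI impI, elim conjE)
  fix n k :: nat and p q :: real
  assume n: "0 < n" and p: "0 \<le> p" "p \<le> 1" and q: "q = min p (1 - p)"
    and qn: "q \<ge> 100 * ln (real n) / sqrt (real n)" and kq: "real k \<le> q * sqrt (real n) / 100"
  define V where "V = {1..n}"
  define E where "E = nsets V 2"
  define \<U> where "\<U> = {U. U \<subseteq> V \<and> card U = k}"
  have V: "finite V" "card V = n" by (auto simp: V_def)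
  have finE: "finite E" using V by (simp add: E_def finite_imp_finite_nsets)
  have fin\<U>: "finite \<U>" using V by (simp add: \<U>_def)
  have q01: "0 \<le> q" "q \<le> 1 / 2" using p q by (auto simp: min_def)
  have "1 \<le> sqrt (real n)" using n by simp
  hence "q * sqrt (real n) \<le> 1 * (sqrt (real n) * sqrt (real n))"
    using q01 mult_mono[OF _ mult_right_mono[of 1 "sqrt (real n)" "sqrt (real n)"], of q 1] by simp
  hence kn: "k \<le> n" using kq n by simp
  have q2: "0 \<le> 1 - q\<^sup>2 / 2"
  proof -
    have "q\<^sup>2 \<le> 1\<^sup>2" using q01 by (intro power_mono) auto
    thus ?thesis by simp
  qed
  define bad where "bad = (\<lambda>U F. \<exists>H. simple_graph H \<and> verts H = U \<and> \<not> has_vertex_minor (V, F) H)"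
  have "bexp p E (\<lambda>F. of_bool (\<not> vertex_minor_universal k (V, F)))
      \<le> bexp p E (\<lambda>F. \<Sum>U\<in>\<U>. of_bool (bad U F))"
  proof (intro bexp_mono p)
    fix F
    show "of_bool (\<not> vertex_minor_universal k (V, F)) \<le> (\<Sum>U\<in>\<U>. of_bool (bad U F) :: real)"
    proof (cases "vertex_minor_universal k (V, F)")
      case False
      then obtain U where U: "U \<in> \<U>" "bad U F"
        by (auto simp: vertex_minor_universal_def \<U>_def bad_def)
      have "(of_bool (bad U F) :: real) \<le> (\<Sum>U\<in>\<U>. of_bool (bad U F))"
        using U fin\<U> by (intro member_le_sum) auto
      thus ?thesis using U False by simp
    qed (auto intro: sum_nonneg)
  qed
  also have "\<dots> = (\<Sum>U\<in>\<U>. bexp p E (\<lambda>F. of_bool (bad U F)))"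
    by (rule bexp_sum)
  also have "\<dots> \<le> (\<Sum>U\<in>\<U>. 2 ^ (k\<^sup>2) * (1 - q\<^sup>2 / 2) ^ (n - k))"
  proof (rule sum_mono)
    fix U assume "U \<in> \<U>"
    hence U: "U \<subseteq> V" "card U = k" "finite U"
      using V finite_subset by (auto simp: \<U>_def)
    have "bexp p E (\<lambda>F. of_bool (bad U F)) \<le> 4 ^ card (nsets U 2) * (1 - q\<^sup>2 / 2) ^ card (V - U)"
      unfolding E_def bad_def by (rule vertex_minors_on_set_bound[OF p q V(1) U(1)])
    also have "card (V - U) = n - k"
      using U V by (simp add: card_Diff_subset)
    also have "(4::real) ^ card (nsets U 2) = 2 ^ (2 * (k choose 2))"
      using U by (simp add: power_mult)
    also have "(2::real) ^ (2 * (k choose 2)) \<le> 2 ^ (k\<^sup>2)"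
    proof (rule power_increasing)
      have "2 * (k choose 2) \<le> k * (k - 1)"
        unfolding choose_two by (rule times_div_less_eq_dividend)
      also have "\<dots> \<le> k\<^sup>2" by (simp add: power2_eq_square)
      finally show "2 * (k choose 2) \<le> k\<^sup>2" .
    qed simp
    finally show "bexp p E (\<lambda>F. of_bool (bad U F)) \<le> 2 ^ (k\<^sup>2) * (1 - q\<^sup>2 / 2) ^ (n - k)"
      using q2 by (simp add: mult_right_mono)
  qed
  also have "\<dots> = real (n choose k) * (2 ^ (k\<^sup>2) * (1 - q\<^sup>2 / 2) ^ (n - k))"
    using n_subsets[OF V(1), of k] V by (simp add: \<U>_def)
  also have "\<dots> \<le> real (n ^ k) * (2 ^ (k\<^sup>2) * (1 - q\<^sup>2 / 2) ^ (n - k))"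
    using q2 binomial_le_pow[OF kn] by (intro mult_right_mono) (auto simp del: of_nat_power)
  also have "\<dots> \<le> 2 powr (- (q\<^sup>2 * real n / 100))"
    by (rule exponent_bound[OF q01 n qn kq kn])
  finally have fail: "bexp p E (\<lambda>F. of_bool (\<not> vertex_minor_universal k (V, F)))
      \<le> 2 powr (- (q\<^sup>2 * real n / 100))" .
  have "measure_pmf.prob (random_graph n p) {G. vertex_minor_universal k G} +
      bexp p E (\<lambda>F. of_bool (\<not> vertex_minor_universal k (V, F))) = bexp p E (\<lambda>_. 1)"
    unfolding prob_random_graph[OF p] V_def[symmetric] E_def[symmetric] bexp_add[symmetric]
    by (intro bexp_cong) auto
  with fail bexp_const[OF finE, of p 1]
  show "measure_pmf.prob (random_graph n p) {G. vertex_minor_universal k G}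
      \<ge> 1 - 2 powr (- (q\<^sup>2 * real n / 100))" by linarith
qed

end
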